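(* Let $\{B_n(x)\}_{n=0}^\infty$ be a sequence in $\mathbb{R}[x]$ with $\deg(B_n(x))=n$ for every $n\in\mathbb{N}_0$ (and $B_0(x)\not\equiv 0$), let $\{a_n\}_{n=0}^\infty$ be a sequence of real numbers, and let $\{Q_k(x)\}_{k=0}^\infty$ be a sequence in $\mathbb{R}[x]$ such that the linear operator $T=\sum_{k=0}^\infty Q_k(x)D^k:\mathbb{R}[x]\to\mathbb{R}[x]$ satisfies $$T[B_n(x)]=\left(\sum_{k=0}^\infty Q_k(x)D^k\right)B_n(x)=a_nB_n(x)\quad\text{for every } n\in\mathbb{N}_0 .$$ Then for every $n\in\mathbb{N}_0$, $$a_n=\sum_{k=0}^n \binom{n}{k}Q_k^{(k)}$$ and $$Q_n^{(n)}=\sum_{k=0}^n\binom{n}{k}a_k(-1)^{n-k}.$$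
   Context: $\mathbb{N}_0=\{0,1,2,\dots\}$ and $D=\frac{d}{dx}$. The operator $\sum_{k=0}^\infty Q_k(x)D^k$ acts on $p\in\mathbb{R}[x]$ by $p\mapsto\sum_{k=0}^{\infty}Q_k(x)p^{(k)}(x)$, a finite sum since $p^{(k)}=0$ for $k>\deg p$. $Q_k^{(k)}$ denotes the $k$-th derivative of the polynomial $Q_k(x)$; the two displayed identities are identities in $\mathbb{R}[x]$, with real numbers regarded as constant polynomials (so in particular $Q_n^{(n)}$ is a constant). *)

theory Defs
  imports Complex_Main "HOL-Computational_Algebra.Polynomial"
begin

(* The formal series stops at k = degree p, because every later derivative of p vanishes;
   see diff_op_eq_sum. *)
definition diff_op :: "(nat \<Rightarrow> real poly) \<Rightarrow> real poly \<Rightarrow> real poly" where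
  "diff_op Q p = (\<Sum>k\<le>degree p. Q k * (pderiv ^^ k) p)"

lemma diff_op_eq_sum:
  assumes "degree p \<le> N"
  shows "diff_op Q p = (\<Sum>k\<le>N. Q k * (pderiv ^^ k) p)"
proof -
  have "(pderiv ^^ k) p = 0" if "degree p < k" for k
    using that by (intro poly_eqI) (simp add: coeff_higher_pderiv coeff_eq_0)
  then show ?thesis
    unfolding diff_op_def using assms by (intro sum.mono_neutral_left) auto
qed

end

theory Submission
  imports Defs
begin

text \<open>
  Write \<open>T\<close> for \<open>diff_op Q\<close>.  The equation \<open>T (B n) = a n B n\<close> is read twice.  Read for degrees, it bounds the
  coefficients of the operator: in \<open>T (B n)\<close> the last term is \<open>Q n\<close> times the nonzero constant
  \<open>(B n)^(n)\<close>, so \<open>Q n\<close> is determined by \<open>B n\<close> and the terms with \<open>k < n\<close>.  If these have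
  degree at most \<open>n\<close>, so does \<open>Q n\<close>, and induction gives \<open>degree (Q n) \<le> n\<close> for all \<open>n\<close>
  (\<open>degree_coefficient_le\<close>).  Hence \<open>T\<close> does not raise degrees and \<open>(Q k)^(k)\<close> is the constant
  \<open>k!\<close> times the coefficient of \<open>x^k\<close> in \<open>Q k\<close>.

  Read at \<open>x^n\<close>, the equation says that \<open>a n\<close> is the factor by which \<open>T\<close> multiplies leading
  coefficients in degree \<open>n\<close>.  Each \<open>Q k * D^k\<close> multiplies them by
  \<open>n (n - 1) \<dots> (n - k + 1)\<close> times the coefficient of \<open>x^k\<close> in \<open>Q k\<close>, that is, by
  \<open>n choose k\<close> times \<open>(Q k)^(k)\<close> (\<open>coeff_mult_higher_pderiv_top\<close>).  Summation gives the first
  identity.  The second is its inverse under the binomial transform (\<open>binomial_inversion\<close>).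
\<close>

text \<open>
  By \<open>choose_mult\<close> the sum is \<open>n choose j\<close> times the binomial expansion of \<open>(1 - 1)^(n - j)\<close>.
\<close>

lemma sum_alternating_choose_mult:
  assumes "j \<le> n"
  shows "(\<Sum>k\<le>n. (-1) ^ (n - k) * of_nat (n choose k) * of_nat (k choose j)) =
    (if j = n then 1 else 0 :: 'a :: comm_ring_1)"
proof -
  have "(\<Sum>k\<le>n. (-1) ^ (n - k) * of_nat (n choose k) * of_nat (k choose j)) =
      (\<Sum>k=j..n. (-1) ^ (n - k) * of_nat (n choose k) * of_nat (k choose j) :: 'a)"
    by (intro sum.mono_neutral_right) (auto simp: binomial_eq_0)
  also have "\<dots> = (\<Sum>k=j..n. of_nat (n choose j) *
      (of_nat ((n - j) choose (k - j)) * (-1) ^ (n - k)))"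
  proof (intro sum.cong refl)
    fix k assume "k \<in> {j..n}"
    then have "of_nat ((n choose k) * (k choose j)) =
        (of_nat ((n choose j) * ((n - j) choose (k - j))) :: 'a)"
      by (simp only: choose_mult atLeastAtMost_iff)
    then have "of_nat (n choose k) * of_nat (k choose j) =
        (of_nat (n choose j) * of_nat ((n - j) choose (k - j)) :: 'a)"
      by (simp only: of_nat_mult)
    then have "(-1) ^ (n - k) * (of_nat (n choose k) * of_nat (k choose j)) =
        ((-1) ^ (n - k) * (of_nat (n choose j) * of_nat ((n - j) choose (k - j))) :: 'a)"
      by (rule arg_cong)
    then show "(-1) ^ (n - k) * of_nat (n choose k) * of_nat (k choose j) =
        (of_nat (n choose j) * (of_nat ((n - j) choose (k - j)) * (-1) ^ (n - k)) :: 'a)"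
      by (simp only: mult_ac)
  qed
  also have "\<dots> = of_nat (n choose j) *
      (\<Sum>k=j..n. of_nat ((n - j) choose (k - j)) * (-1) ^ (n - k))"
    by (simp add: sum_distrib_left)
  also have "(\<Sum>k=j..n. of_nat ((n - j) choose (k - j)) * (-1) ^ (n - k)) =
      (\<Sum>i\<le>n - j. of_nat ((n - j) choose i) * (-1) ^ (n - j - i) :: 'a)"
    using assms
    by (intro sum.reindex_bij_witness[of _ "\<lambda>i. i + j" "\<lambda>k. k - j"]) auto
  also have "\<dots> = (1 + (-1)) ^ (n - j)"
    by (subst binomial_ring) simp
  finally show ?thesis
    using assms by (auto simp: zero_power)
qed

lemma binomial_inversion:
  fixes a c :: "nat \<Rightarrow> 'a :: comm_ring_1"
  assumes "\<And>k. k \<le> n \<Longrightarrow> a k = (\<Sum>j\<le>k. of_nat (k choose j) * c j)"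
  shows "c n = (\<Sum>k\<le>n. of_nat (n choose k) * a k * (-1) ^ (n - k))"
proof -
  \<comment> \<open>A range independent of \<open>k\<close>, so that the two summations can be exchanged.\<close>
  have extend: "a k = (\<Sum>j\<le>n. of_nat (k choose j) * c j)" if "k \<le> n" for k
    unfolding assms[OF that] using that
    by (intro sum.mono_neutral_left) (auto simp: binomial_eq_0)
  have "(\<Sum>k\<le>n. of_nat (n choose k) * a k * (-1) ^ (n - k)) =
      (\<Sum>k\<le>n. \<Sum>j\<le>n. c j * ((-1) ^ (n - k) * of_nat (n choose k) * of_nat (k choose j)))"
    by (intro sum.cong refl) (simp add: extend sum_distrib_left sum_distrib_right mult_ac)
  also have "\<dots> = (\<Sum>j\<le>n. c j *
      (\<Sum>k\<le>n. (-1) ^ (n - k) * of_nat (n choose k) * of_nat (k choose j)))"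
    by (subst sum.swap) (simp add: sum_distrib_left)
  also have "\<dots> = (\<Sum>j\<le>n. c j * (if j = n then 1 else 0))"
    by (intro sum.cong refl) (simp only: sum_alternating_choose_mult atMost_iff)
  also have "\<dots> = c n"
    by (simp add: if_distrib[of "\<lambda>x. _ * x"] cong: if_cong)
  finally show ?thesis ..
qed

lemma coeff_mult_top:
  fixes p q :: "'a :: comm_semiring_0 poly"
  assumes "degree p \<le> m" and "degree q \<le> n"
  shows "coeff (p * q) (m + n) = coeff p m * coeff q n"
proof -
  have "coeff (p * q) (m + n) = (\<Sum>i\<le>m + n. coeff p i * coeff q (m + n - i))"
    by (rule coeff_mult)
  also have "\<dots> = (\<Sum>i\<in>{m}. coeff p i * coeff q (m + n - i))"
  proof (rule sum.mono_neutral_right, simp, simp, intro ballI)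
    fix i assume "i \<in> {..m + n} - {m}"
    then have "m < i \<or> n < m + n - i"
      by auto
    then show "coeff p i * coeff q (m + n - i) = 0"
      using assms by (auto simp: coeff_eq_0)
  qed
  finally show ?thesis
    by simp
qed

lemma higher_pderiv_eq_const:
  fixes p :: "real poly"
  assumes "degree p \<le> k"
  shows "(pderiv ^^ k) p = [:fact k * coeff p k:]"
proof (rule poly_eqI)
  show "coeff ((pderiv ^^ k) p) i = coeff [:fact k * coeff p k:] i" for i
    using assms
    by (cases i) (simp_all add: coeff_higher_pderiv pochhammer_fact coeff_eq_0)
qed

text \<open>
  The falling factorial produced by \<open>k\<close> differentiations of \<open>x^n\<close> is \<open>n choose k\<close> times \<open>k!\<close>,
  and \<open>k! * coeff q k\<close> is the value of the constant \<open>q^(k)\<close>.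
\<close>

lemma coeff_mult_higher_pderiv_top:
  fixes p q :: "real poly"
  assumes "degree q \<le> k" and "degree p \<le> n" and "k \<le> n"
  shows "coeff (q * (pderiv ^^ k) p) n =
    of_nat (n choose k) * (fact k * coeff q k) * coeff p n"
proof -
  have "degree ((pderiv ^^ k) p) \<le> n - k"
    using assms by (simp add: degree_higher_pderiv)
  then have "coeff (q * (pderiv ^^ k) p) n = coeff q k * coeff ((pderiv ^^ k) p) (n - k)"
    using coeff_mult_top[OF assms(1), of "(pderiv ^^ k) p" "n - k"] assms(3) by simp
  also have "coeff ((pderiv ^^ k) p) (n - k) =
      pochhammer (of_nat n - of_nat k + 1) k * coeff p n"
    using assms(3) by (simp add: coeff_higher_pderiv of_nat_diff algebra_simps)
  also have "pochhammer (of_nat n - of_nat k + 1) k = (of_nat (n choose k) * fact k :: real)"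
    by (simp add: binomial_gbinomial gbinomial_pochhammer')
  finally show ?thesis
    by (simp add: mult_ac)
qed

text \<open>
  The eigenvalue equation of \<open>B n\<close> can be solved for the last term of \<open>T (B n)\<close>, which is a
  nonzero scalar multiple of \<open>Q n\<close> since \<open>(B n)^(n)\<close> is a nonzero constant.
\<close>

lemma degree_coefficient_le:
  fixes B Q :: "nat \<Rightarrow> real poly"
  assumes deg: "\<And>n. degree (B n) = n"
    and nz: "\<And>n. B n \<noteq> 0"
    and eigen: "\<And>n. diff_op Q (B n) = smult (a n) (B n)"
  shows "degree (Q n) \<le> n"
proof (induction n rule: less_induct)
  case (less n)
  define c where "c = fact n * coeff (B n) n"
  have "c \<noteq> 0"
    using nz[of n] deg[of n] leading_coeff_0_iff[of "B n"] by (simp add: c_def)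
  have "smult (a n) (B n) = (\<Sum>k\<le>n. Q k * (pderiv ^^ k) (B n))"
    using eigen[of n] by (simp add: diff_op_def deg)
  also have "\<dots> = (\<Sum>k<n. Q k * (pderiv ^^ k) (B n)) + smult c (Q n)"
    by (simp add: lessThan_Suc_atMost[symmetric] higher_pderiv_eq_const deg c_def)
  finally have "smult c (Q n) = smult (a n) (B n) - (\<Sum>k<n. Q k * (pderiv ^^ k) (B n))"
    by simp
  also have "degree \<dots> \<le> n"
  proof (intro degree_diff_le degree_sum_le)
    show "degree (smult (a n) (B n)) \<le> n"
      using degree_smult_le[of "a n" "B n"] by (simp add: deg)
    fix k assume "k \<in> {..<n}"
    then have "degree (Q k) + degree ((pderiv ^^ k) (B n)) \<le> k + (n - k)"
      using less.IH[of k] by (simp add: degree_higher_pderiv deg)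
    then show "degree (Q k * (pderiv ^^ k) (B n)) \<le> n"
      using degree_mult_le[of "Q k" "(pderiv ^^ k) (B n)"] \<open>k \<in> {..<n}\<close> by simp
  qed simp
  finally show ?case
    using \<open>c \<noteq> 0\<close> by simp
qed

theorem theorem7:
  fixes B :: "nat \<Rightarrow> real poly"
    and a :: "nat \<Rightarrow> real"
    and Q :: "nat \<Rightarrow> real poly"
  assumes "\<And>n. degree (B n) = n"
    and "B 0 \<noteq> 0"
    and "\<And>n. diff_op Q (B n) = smult (a n) (B n)"
  shows "\<forall>n. [:a n:] = (\<Sum>k\<le>n. smult (of_nat (n choose k)) ((pderiv ^^ k) (Q k))) \<and>
             (pderiv ^^ n) (Q n) = [:\<Sum>k\<le>n. of_nat (n choose k) * a k * (-1) ^ (n - k):]"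
proof -
  have nz: "B n \<noteq> 0" for n
    using assms(1)[of n] assms(2) by (cases "n = 0") auto
  have degQ: "degree (Q n) \<le> n" for n
    using degree_coefficient_le[OF assms(1) nz assms(3)] .
  define c where "c k = fact k * coeff (Q k) k" for k
  have Q_const: "(pderiv ^^ k) (Q k) = [:c k:]" for k
    unfolding c_def using degQ by (rule higher_pderiv_eq_const)
  have a_eq: "a n = (\<Sum>k\<le>n. of_nat (n choose k) * c k)" for n
  proof -
    have "a n * coeff (B n) n = coeff (diff_op Q (B n)) n"
      by (simp add: assms(3))
    also have "\<dots> = (\<Sum>k\<le>n. coeff (Q k * (pderiv ^^ k) (B n)) n)"
      by (simp add: diff_op_def assms(1) coeff_sum)
    also have "\<dots> = (\<Sum>k\<le>n. of_nat (n choose k) * c k * coeff (B n) n)"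
      unfolding c_def
      by (intro sum.cong refl coeff_mult_higher_pderiv_top) (simp_all add: degQ assms(1))
    also have "\<dots> = (\<Sum>k\<le>n. of_nat (n choose k) * c k) * coeff (B n) n"
      by (simp add: sum_distrib_right)
    finally show ?thesis
      using nz[of n] assms(1)[of n] leading_coeff_0_iff[of "B n"] by simp
  qed
  show ?thesis
  proof (intro allI conjI)
    fix n
    show "[:a n:] = (\<Sum>k\<le>n. smult (of_nat (n choose k)) ((pderiv ^^ k) (Q k)))"
      by (rule poly_eqI) (simp add: Q_const a_eq coeff_sum coeff_pCons split: nat.split)
    show "(pderiv ^^ n) (Q n) = [:\<Sum>k\<le>n. of_nat (n choose k) * a k * (-1) ^ (n - k):]"
      unfolding Q_const using binomial_inversion[of n a c] a_eq by simp
  qed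
qed

end
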